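(* Let $d\ge 1$ and let $K\subseteq\mathbb{R}^d$ be a convex body. (1) If $\mathrm{width}(K)\ge 2\,\mathrm{Flt}(d)\,d$, then $K$ contains a unimodular copy of the standard simplex $\Delta_d$. (2) If $\mathrm{width}(K)\ge \mathrm{Flt}(d)\,d$, then $K$ contains an $\mathbb{R}$-unimodular copy of $\Delta_d$.
   Context: A convex body is a non-empty compact convex subset of $\mathbb{R}^d$. For a non-zero linear functional $u$, $\mathrm{width}_u(K)=\max_{x,y\in K}|u(x)-u(y)|$, and the lattice width is $\mathrm{width}(K)=\min_{u\in(\mathbb{Z}^d)^*\setminus\{0\}}\mathrm{width}_u(K)$, where $(\mathbb{Z}^d)^*=\mathrm{Hom}(\mathbb{Z}^d,\mathbb{Z})$. The flatness constant is $\mathrm{Flt}(d)=\sup\{\mathrm{width}(K): K\subseteq\mathbb{R}^d \text{ convex body}, K\cap\mathbb{Z}^d=\emptyset\}$ (a finite real number). A unimodular transformation is a map $x\mapsto Ax+b$ with $A\in\mathrm{GL}(d,\mathbb{Z})$ (integer matrix of determinant $\pm1$) and $b\in\mathbb{Z}^d$; an $\mathbb{R}$-unimodular transformation is the same with $b\in\mathbb{R}^d$. For $X\subseteq\mathbb{R}^d$, $T(X)$ is called a unimodular (resp. $\mathbb{R}$-unimodular) copy of $X$ for $T$ unimodular (resp. $\mathbb{R}$-unimodular). The standard simplex is $\Delta_d=\mathrm{conv}(0,e_1,\dots,e_d)$. *)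

theory Defs
  imports "HOL-Analysis.Analysis"
begin

definition lattice_points :: "(real^'n) set" where
  "lattice_points = {x. \<forall>i. x $ i \<in> \<int>}"

definition convex_body :: "(real^'n) set \<Rightarrow> bool" where
  "convex_body K \<longleftrightarrow> K \<noteq> {} \<and> compact K \<and> convex K"

text \<open>Integer linear functionals (Z^d)^* are identified with integer vectors u, acting by x \<mapsto> u \<bullet> x.\<close>

definition width_dir :: "real^'n \<Rightarrow> (real^'n) set \<Rightarrow> real" where
  "width_dir u K = Sup {\<bar>u \<bullet> x - u \<bullet> y\<bar> | x y. x \<in> K \<and> y \<in> K}"

definition lattice_width :: "(real^'n) set \<Rightarrow> real" where
  "lattice_width K = Inf {width_dir u K | u. u \<in> lattice_points \<and> u \<noteq> 0}"

definition Flt :: "'n::finite itself \<Rightarrow> real" where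
  "Flt _ = Sup {lattice_width K | K :: (real^'n) set. convex_body K \<and> K \<inter> lattice_points = {}}"

definition unimodular_matrix :: "real^'n^'n \<Rightarrow> bool" where
  "unimodular_matrix A \<longleftrightarrow> (\<forall>i j. A $ i $ j \<in> \<int>) \<and> (det A = 1 \<or> det A = -1)"

definition unimodular_map :: "(real^'n \<Rightarrow> real^'n) \<Rightarrow> bool" where
  "unimodular_map T \<longleftrightarrow> (\<exists>A b. unimodular_matrix A \<and> b \<in> lattice_points \<and> T = (\<lambda>x. A *v x + b))"

definition R_unimodular_map :: "(real^'n \<Rightarrow> real^'n) \<Rightarrow> bool" where
  "R_unimodular_map T \<longleftrightarrow> (\<exists>A b. unimodular_matrix A \<and> T = (\<lambda>x. A *v x + b))"

definition std_simplex :: "(real^'n) set" where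
  "std_simplex = convex hull (insert 0 {axis i 1 | i. True})"

end

theory Submission
  imports Defs
begin

text \<open>Let \<open>d\<close> be the dimension. Flatness, with some finite bound, follows by induction on the
  dimension by slicing a wide body in an integer layer orthogonal to a thinnest direction; so
  \<open>Flt\<close> is a genuine supremum, and if \<open>K\<close> has width at least \<open>d Flt\<close> then every translate of
  \<open>C = K / d\<close> contains a lattice point.

  Such a \<open>C\<close> admits points \<open>x\<^sub>j, y\<^sub>j\<close> in \<open>C\<close> and a lattice basis \<open>b\<close> with
  \<open>b\<^sub>k \<in> c\<^sub>k + \<Sum>\<^sub>j\<^sub><\<^sub>k [0,1] c\<^sub>j\<close>, where \<open>c\<^sub>j = x\<^sub>j - y\<^sub>j\<close>. Given \<open>b\<^sub>j\<close> for \<open>j < k\<close> with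
  span \<open>L\<close>, connectedness of the space yields a lattice vector in \<open>C - C\<close> outside \<open>L\<close>; shrink it
  to a vector \<open>c\<^sub>k\<close> that generates the lattice modulo \<open>L\<close>, and correct it by an element of the
  parallelepiped of \<open>c\<^sub>0, \<dots>, c\<^sub>k\<^sub>-\<^sub>1\<close>, whose lattice translates cover \<open>L\<close>. Then \<open>p = \<Sum>\<^sub>j y\<^sub>j\<close> and
  all \<open>p + b\<^sub>i\<close> lie in \<open>d C = K\<close>. If the width is at least \<open>2 d Flt\<close>, this simplex fits in \<open>K / 2\<close>
  and the other half of \<open>K\<close> serves to move \<open>p\<close> to a lattice point.\<close>

section \<open>The flatness theorem\<close>

lemma segment_crossing_bound:
  fixes C :: "'a::real_inner set"
  assumes C: "convex C" "e \<in> C" "c \<in> C" "x \<in> C"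
    and \<theta>: "1/3 \<le> \<theta>" "\<theta> \<le> 1" "\<theta> * (u \<bullet> x - u \<bullet> e) = k - u \<bullet> e"
    and c: "u \<bullet> c = k" "(v - t *\<^sub>R u) \<bullet> c = (v - t *\<^sub>R u) \<bullet> e"
    and sec: "\<forall>x\<in>C. \<forall>y\<in>C. u \<bullet> x = k \<longrightarrow> u \<bullet> y = k \<longrightarrow> v \<bullet> x - v \<bullet> y \<le> s"
  shows "\<bar>(v - t *\<^sub>R u) \<bullet> x - (v - t *\<^sub>R u) \<bullet> e\<bar> \<le> 3 * s"
proof -
  define g where "g = v - t *\<^sub>R u"
  define y where "y = (1 - \<theta>) *\<^sub>R e + \<theta> *\<^sub>R x"
  have y: "y \<in> C"
    unfolding y_def using C \<theta> by (intro convexD_alt) auto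
  have uy: "u \<bullet> y = k"
    using \<theta>(3) by (simp add: y_def inner_simps algebra_simps)
  have "g \<bullet> y - g \<bullet> c = \<theta> * (g \<bullet> x - g \<bullet> e)"
    using c(2) by (simp add: y_def g_def[symmetric] inner_simps algebra_simps)
  \<comment> \<open>Both \<open>y\<close> and \<open>c\<close> lie on the layer where
    \<open>u\<close> equals \<open>k\<close>, so the multiple of \<open>u\<close> in
    \<open>g\<close> cancels and the thinness of the section applies.\<close>
  moreover have "g \<bullet> y - g \<bullet> c = v \<bullet> y - v \<bullet> c"
    using uy c(1) by (simp add: g_def inner_simps)
  moreover have "\<bar>v \<bullet> y - v \<bullet> c\<bar> \<le> s"
    using sec y C(3) uy c(1) by (auto simp: abs_le_iff)
  ultimately have "\<theta> * \<bar>g \<bullet> x - g \<bullet> e\<bar> \<le> s"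
    using \<theta>(1) by (simp add: abs_mult)
  moreover have "1/3 * \<bar>g \<bullet> x - g \<bullet> e\<bar> \<le> \<theta> * \<bar>g \<bullet> x - g \<bullet> e\<bar>"
    using \<theta>(1) by (intro mult_right_mono) auto
  ultimately show ?thesis
    by (simp add: g_def)
qed

text \<open>Choose \<open>t\<close> so that \<open>g = v - t u\<close> takes one value at the two
  extremal points \<open>p\<close> and \<open>q\<close>, hence also at the point \<open>c\<close>
  where the segment between them meets the layer. Any \<open>x\<close> in \<open>C\<close> is joined
  to the extremal point on the other side of the layer. As the layer lies in the middle third of the
  range of \<open>u\<close>, at least a third of this segment, measured from the extremal point,
  precedes the crossing, so \<open>g\<close> at \<open>x\<close> is within \<open>3 * s\<close> of
  the common value.\<close>

lemma width_le_of_section: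
  fixes C :: "'a::real_inner set"
  assumes C: "convex C" "p \<in> C" "q \<in> C"
    and range: "\<And>x. x \<in> C \<Longrightarrow> u \<bullet> q \<le> u \<bullet> x \<and> u \<bullet> x \<le> u \<bullet> p"
    and k: "u \<bullet> q < k" "k < u \<bullet> p"
      "u \<bullet> p - k \<le> 2 * (k - u \<bullet> q)" "k - u \<bullet> q \<le> 2 * (u \<bullet> p - k)"
    and sec: "\<forall>x\<in>C. \<forall>y\<in>C. u \<bullet> x = k \<longrightarrow> u \<bullet> y = k \<longrightarrow> v \<bullet> x - v \<bullet> y \<le> s"
  obtains t where "\<And>x y. x \<in> C \<Longrightarrow> y \<in> C \<Longrightarrow> (v - t *\<^sub>R u) \<bullet> x - (v - t *\<^sub>R u) \<bullet> y \<le> 6 * s"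
proof -
  define w where "w = u \<bullet> p - u \<bullet> q"
  have w: "w > 0"
    using k by (simp add: w_def)
  define t where "t = (v \<bullet> p - v \<bullet> q) / w"
  define g where "g = v - t *\<^sub>R u"
  have "t * w = v \<bullet> p - v \<bullet> q"
    using w by (simp add: t_def)
  then have gpq: "g \<bullet> p = g \<bullet> q"
    by (simp add: g_def w_def inner_simps algebra_simps)
  define \<mu> where "\<mu> = (k - u \<bullet> q) / w"
  have \<mu>: "0 \<le> \<mu>" "\<mu> \<le> 1" "\<mu> * w = k - u \<bullet> q"
    using k w by (auto simp: \<mu>_def w_def)
  define c where "c = (1 - \<mu>) *\<^sub>R q + \<mu> *\<^sub>R p"
  have c: "c \<in> C"
    unfolding c_def using C \<mu> by (intro convexD_alt) auto
  have uc: "u \<bullet> c = k"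
    using \<mu>(3) by (simp add: c_def w_def inner_simps algebra_simps)
  have gc: "g \<bullet> c = g \<bullet> q"
    using gpq by (simp add: c_def inner_simps algebra_simps)
  have bound: "\<bar>g \<bullet> x - g \<bullet> q\<bar> \<le> 3 * s" if x: "x \<in> C" for x
  proof (cases "u \<bullet> x \<ge> k")
    case True
    define \<theta> where "\<theta> = (k - u \<bullet> q) / (u \<bullet> x - u \<bullet> q)"
    have "1/3 \<le> \<theta>" "\<theta> \<le> 1" "\<theta> * (u \<bullet> x - u \<bullet> q) = k - u \<bullet> q"
      using True k range[OF x] by (auto simp: \<theta>_def field_simps)
    then show ?thesis
      using segment_crossing_bound[OF C(1,3) c x _ _ _ uc _ sec, of \<theta> t] gc
      by (simp add: g_def)
  next
    case False
    define \<theta> where "\<theta> = (u \<bullet> p - k) / (u \<bullet> p - u \<bullet> x)"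
    have *: "1/3 \<le> \<theta>" "\<theta> \<le> 1" "\<theta> * (u \<bullet> p - u \<bullet> x) = u \<bullet> p - k"
      using False k range[OF x] by (auto simp: \<theta>_def field_simps)
    then have "\<theta> * (u \<bullet> x - u \<bullet> p) = k - u \<bullet> p"
      by (simp add: algebra_simps)
    then show ?thesis
      using segment_crossing_bound[OF C(1,2) c x *(1,2) _ uc _ sec, of t] gc gpq
      by (simp add: g_def)
  qed
  have "g \<bullet> x - g \<bullet> y \<le> 6 * s" if "x \<in> C" "y \<in> C" for x y
    using bound[OF that(1)] bound[OF that(2)] by linarith
  then show ?thesis
    using that[of t] by (simp add: g_def)
qed

text \<open>The lower bound \<open>a\<close> makes the infimum positive, hence strictly smaller than
  \<open>c\<close> times itself, and some value of \<open>f\<close> falls in between. This avoids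
  having to show that a minimal width is attained.\<close>

lemma obtain_near_minimiser:
  fixes f :: "'a \<Rightarrow> real"
  assumes "S \<noteq> {}" "\<And>x. x \<in> S \<Longrightarrow> a \<le> f x" "0 < a" "1 < c"
  obtains x where "x \<in> S" "\<And>y. y \<in> S \<Longrightarrow> f x \<le> c * f y"
proof -
  define r where "r = Inf (f ` S)"
  have bdd: "bdd_below (f ` S)"
    using assms(2) by (auto intro!: bdd_belowI)
  have "a \<le> r"
    unfolding r_def using assms by (auto intro!: cInf_greatest)
  then have "r < c * r"
    using assms by simp
  then obtain x where x: "x \<in> S" "f x < c * r"
    unfolding r_def using cInf_lessD[of "f ` S"] assms(1) by (metis (no_types, lifting) imageE image_is_empty)
  have "f x \<le> c * f y" if "y \<in> S" for y
  proof -
    have "r \<le> f y"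
      unfolding r_def using bdd that by (auto intro: cInf_lower)
    then have "c * r \<le> c * f y"
      using assms by simp
    then show ?thesis
      using x by linarith
  qed
  then show ?thesis
    using that x by blast
qed

text \<open>Functionals are represented by vectors of \<open>V\<close> through the inner product, so
  that the induction on dimension can run over subspaces of one fixed space.\<close>

definition dual_lattice :: "'a::real_inner set \<Rightarrow> 'a set \<Rightarrow> 'a set" where
  "dual_lattice V \<Lambda> = {u \<in> V. \<forall>z\<in>\<Lambda>. u \<bullet> z \<in> \<int>}"

text \<open>Plays the part of a lattice. Discreteness is encoded in
  \<open>lattice_point_of_wide\<close> by the assumption that the dual lattice spans the
  space.\<close>

definition add_subgroup :: "'a::ab_group_add set \<Rightarrow> bool" where
  "add_subgroup G \<longleftrightarrow> 0 \<in> G \<and> (\<forall>x\<in>G. \<forall>y\<in>G. x - y \<in> G)"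

lemma add_subgroup_zero: "add_subgroup G \<Longrightarrow> 0 \<in> G"
  by (simp add: add_subgroup_def)

lemma add_subgroup_diff: "add_subgroup G \<Longrightarrow> x \<in> G \<Longrightarrow> y \<in> G \<Longrightarrow> x - y \<in> G"
  by (simp add: add_subgroup_def)

lemma add_subgroup_minus: "add_subgroup G \<Longrightarrow> x \<in> G \<Longrightarrow> - x \<in> G"
  using add_subgroup_diff[of G 0 x] by (simp add: add_subgroup_zero)

lemma add_subgroup_add: "add_subgroup G \<Longrightarrow> x \<in> G \<Longrightarrow> y \<in> G \<Longrightarrow> x + y \<in> G"
  using add_subgroup_diff[of G x "- y"] by (simp add: add_subgroup_minus)

lemma add_subgroup_scaleR:
  fixes G :: "'a::real_vector set"
  assumes G: "add_subgroup G" "x \<in> G" "m \<in> \<int>"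
  shows "m *\<^sub>R x \<in> G"
proof -
  have nat: "real n *\<^sub>R x \<in> G" for n
    by (induction n) (auto simp: scaleR_add_left assms add_subgroup_zero add_subgroup_add)
  obtain i :: int where m: "m = of_int i"
    using G(3) by (auto elim: Ints_cases)
  show ?thesis
  proof (cases "i \<ge> 0")
    case True
    then show ?thesis
      using nat[of "nat i"] m by simp
  next
    case False
    then show ?thesis
      using add_subgroup_minus[OF G(1) nat[of "nat (- i)"]] m by simp
  qed
qed

text \<open>The values of \<open>u\<close> on the lattice form a subgroup of the integers. It is
  nonzero, since \<open>u\<close> lies in the span of the lattice and is not orthogonal to itself.
  If its least positive element \<open>m\<close> were at least 2, then \<open>u / m\<close> would
  still be a dual vector, against primitivity.\<close>

lemma obtain_unit_pairing:
  fixes \<Lambda> :: "'a::real_inner set"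
  assumes \<Lambda>: "add_subgroup \<Lambda>"
    and V: "subspace V" "V \<subseteq> span \<Lambda>"
    and u: "u \<in> dual_lattice V \<Lambda>" "u \<noteq> 0"
    and prim: "\<And>m::nat. m \<ge> 2 \<Longrightarrow> (1 / real m) *\<^sub>R u \<notin> dual_lattice V \<Lambda>"
  obtains z where "z \<in> \<Lambda>" "u \<bullet> z = 1"
proof -
  define P where "P m \<longleftrightarrow> m > 0 \<and> (\<exists>z\<in>\<Lambda>. u \<bullet> z = real m)" for m :: nat
  have "\<exists>z\<in>\<Lambda>. u \<bullet> z \<noteq> 0"
  proof (rule ccontr)
    assume "\<not> ?thesis"
    then have "\<And>z. z \<in> \<Lambda> \<Longrightarrow> orthogonal u z"
      by (auto simp: orthogonal_def)
    moreover have "u \<in> span \<Lambda>"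
      using u V by (auto simp: dual_lattice_def)
    ultimately have "orthogonal u u"
      using orthogonal_to_span by blast
    then show False
      using u by (simp add: orthogonal_def)
  qed
  then obtain z where z: "z \<in> \<Lambda>" "u \<bullet> z \<noteq> 0"
    by blast
  obtain i :: int where i: "u \<bullet> z = of_int i"
    using u z by (auto simp: dual_lattice_def elim: Ints_cases)
  have "P (nat \<bar>i\<bar>)"
  proof (cases "i > 0")
    case True
    then show ?thesis
      using z i by (auto simp: P_def intro!: bexI[of _ z])
  next
    case False
    then show ?thesis
      using z i add_subgroup_minus[OF \<Lambda> z(1)]
      by (auto simp: P_def intro!: bexI[of _ "- z"])
  qed
  define m where "m = (LEAST m. P m)"
  have Pm: "P m" and least: "\<And>j. P j \<Longrightarrow> m \<le> j"
    using \<open>P (nat \<bar>i\<bar>)\<close> by (auto simp: m_def intro: LeastI Least_le)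
  obtain y where y: "y \<in> \<Lambda>" "u \<bullet> y = real m" "m > 0"
    using Pm by (auto simp: P_def)
  have "(1 / real m) *\<^sub>R u \<in> dual_lattice V \<Lambda>"
    unfolding dual_lattice_def
  proof (intro CollectI conjI ballI)
    show "(1 / real m) *\<^sub>R u \<in> V"
      using u V by (simp add: dual_lattice_def subspace_scale)
    fix z assume z: "z \<in> \<Lambda>"
    obtain i :: int where i: "u \<bullet> z = of_int i"
      using u z by (auto simp: dual_lattice_def elim: Ints_cases)
    \<comment> \<open>Division with remainder: \<open>r\<close> is again a value of \<open>u\<close>
      on the lattice and is below \<open>m\<close>, so it must vanish.\<close>
    define r where "r = i mod int m"
    have r: "0 \<le> r" "r < int m"
      using y by (auto simp: r_def)
    have ir: "i = int m * (i div int m) + r"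
      by (simp add: r_def)
    have "z - of_int (i div int m) *\<^sub>R y \<in> \<Lambda>"
      using add_subgroup_diff[OF \<Lambda> z add_subgroup_scaleR[OF \<Lambda> y(1)]] by simp
    moreover have "u \<bullet> (z - of_int (i div int m) *\<^sub>R y) = real (nat r)"
    proof -
      have "u \<bullet> (z - of_int (i div int m) *\<^sub>R y) = of_int (i - int m * (i div int m))"
        using i y by (simp add: inner_simps)
      also have "\<dots> = of_int r"
        using ir by (metis add_diff_cancel_left')
      finally show ?thesis
        using r by simp
    qed
    ultimately have "r = 0"
      using least[of "nat r"] r by (force simp: P_def)
    then have "of_int i = real m * of_int (i div int m)"
      using ir by (metis add.right_neutral of_int_mult of_int_of_nat_eq)
    then have "((1 / real m) *\<^sub>R u) \<bullet> z = of_int (i div int m)"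
      using i y by (simp add: field_simps)
    then show "((1 / real m) *\<^sub>R u) \<bullet> z \<in> \<int>"
      by simp
  qed
  then have "m = 1"
    using prim[of m] y by (cases "m \<ge> 2") auto
  then show ?thesis
    using that y by simp
qed

text \<open>With \<open>f\<close> the bound in dimension \<open>k\<close>, a thin slice would give
  \<open>W \<le> 3/2 * (6 * f + W / 2)\<close> for the near-minimal width \<open>W\<close>, that is
  \<open>W \<le> 36 * f\<close>. The summand 3 makes the contradiction strict and guarantees an
  integer layer in the middle third of the body.\<close>

primrec flatness_bound :: "nat \<Rightarrow> real" where
  "flatness_bound 0 = 1"
| "flatness_bound (Suc k) = 36 * flatness_bound k + 3"

lemma flatness_bound_pos: "flatness_bound k > 0"
  by (induction k) auto

text \<open>Applying \<open>f\<close> to a combination of \<open>S\<close> that represents a point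
  of \<open>W\<close> fixes the point and yields a combination of \<open>T\<close>. It is used for
  two projections onto the kernel of \<open>u\<close>: along \<open>w\<close> for the lattice, and
  orthogonally for the dual lattice.\<close>

lemma span_transfer:
  fixes f :: "'a::real_vector \<Rightarrow> 'a"
  assumes "linear f" "W \<subseteq> span S" "\<And>x. x \<in> W \<Longrightarrow> f x = x" "f ` S \<subseteq> T"
  shows "W \<subseteq> span T"
proof
  fix x assume x: "x \<in> W"
  have "f x \<in> span (f ` S)"
    using assms(1,2) x linear_span_image by (metis imageI subsetD)
  then show "x \<in> span T"
    using assms(3)[OF x] span_mono[OF assms(4)] by auto
qed

section \<open>Restriction of a lattice and its dual to the kernel of a dual vector that takes the
  value 1\<close>

context
  fixes V \<Lambda> :: "'a::euclidean_space set" and u w :: 'a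
  assumes V: "subspace V"
    and \<Lambda>: "add_subgroup \<Lambda>" "\<Lambda> \<subseteq> V"
    and u: "u \<in> dual_lattice V \<Lambda>"
    and w: "w \<in> \<Lambda>" "u \<bullet> w = 1"
begin

lemma kernel_subspace: "subspace (V \<inter> {x. u \<bullet> x = 0})"
  using V by (simp add: subspace_inter subspace_hyperplane)

lemma kernel_add_subgroup: "add_subgroup (\<Lambda> \<inter> {x. u \<bullet> x = 0})"
  using \<Lambda> by (auto simp: add_subgroup_def inner_simps)

lemma kernel_span:
  assumes "V \<subseteq> span \<Lambda>"
  shows "V \<inter> {x. u \<bullet> x = 0} \<subseteq> span (\<Lambda> \<inter> {x. u \<bullet> x = 0})"
proof (rule span_transfer)
  show "linear (\<lambda>x. x - (u \<bullet> x) *\<^sub>R w)"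
    by (intro linearI) (simp_all add: inner_simps algebra_simps)
  show "V \<inter> {x. u \<bullet> x = 0} \<subseteq> span \<Lambda>"
    using assms by auto
  show "(\<lambda>x. x - (u \<bullet> x) *\<^sub>R w) ` \<Lambda> \<subseteq> \<Lambda> \<inter> {x. u \<bullet> x = 0}"
    using u w \<Lambda>
    by (auto simp: inner_simps dual_lattice_def intro!: add_subgroup_diff add_subgroup_scaleR)
qed auto

text \<open>The lattice is the direct sum of its kernel part and the integer multiples of
  \<open>w\<close>. The vector \<open>v - (v \<bullet> w) u\<close> vanishes on \<open>w\<close> and
  agrees with \<open>v\<close> on the kernel, so it is the extension of \<open>v\<close> by
  zero.\<close>

lemma kernel_dual_extend:
  assumes v: "v \<in> dual_lattice (V \<inter> {x. u \<bullet> x = 0}) (\<Lambda> \<inter> {x. u \<bullet> x = 0})"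
  shows "v - (v \<bullet> w) *\<^sub>R u \<in> dual_lattice V \<Lambda>"
  unfolding dual_lattice_def
proof (intro CollectI conjI ballI)
  show "v - (v \<bullet> w) *\<^sub>R u \<in> V"
    using u v V by (simp add: dual_lattice_def subspace_diff subspace_scale)
  fix z assume z: "z \<in> \<Lambda>"
  have "z - (u \<bullet> z) *\<^sub>R w \<in> \<Lambda> \<inter> {x. u \<bullet> x = 0}"
    using u w \<Lambda> z
    by (auto simp: inner_simps dual_lattice_def intro!: add_subgroup_diff add_subgroup_scaleR)
  then have "v \<bullet> (z - (u \<bullet> z) *\<^sub>R w) \<in> \<int>"
    using v unfolding dual_lattice_def by blast
  then show "(v - (v \<bullet> w) *\<^sub>R u) \<bullet> z \<in> \<int>"
    by (simp add: inner_simps algebra_simps)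
qed

text \<open>Removing the component along \<open>u\<close> does not change the pairing with kernel
  vectors, so orthogonal projection sends dual vectors to dual vectors of the kernel
  lattice.\<close>

lemma kernel_span_dual:
  assumes "V \<subseteq> span (dual_lattice V \<Lambda>)"
  shows "V \<inter> {x. u \<bullet> x = 0}
    \<subseteq> span (dual_lattice (V \<inter> {x. u \<bullet> x = 0}) (\<Lambda> \<inter> {x. u \<bullet> x = 0}))"
proof (rule span_transfer)
  have "u \<noteq> 0"
    using w by auto
  show "linear (\<lambda>x. x - ((u \<bullet> x) / (u \<bullet> u)) *\<^sub>R u)"
    by (intro linearI) (simp_all add: inner_simps algebra_simps add_divide_distrib)
  show "V \<inter> {x. u \<bullet> x = 0} \<subseteq> span (dual_lattice V \<Lambda>)"
    using assms by auto
  show "(\<lambda>x. x - ((u \<bullet> x) / (u \<bullet> u)) *\<^sub>R u) ` dual_lattice V \<Lambda>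
    \<subseteq> dual_lattice (V \<inter> {x. u \<bullet> x = 0}) (\<Lambda> \<inter> {x. u \<bullet> x = 0})"
    using u V \<open>u \<noteq> 0\<close>
    by (auto simp: inner_simps dual_lattice_def subspace_diff subspace_scale)
qed auto

lemma kernel_dim: "dim V = Suc (dim (V \<inter> {x. u \<bullet> x = 0}))"
proof -
  let ?W = "V \<inter> {x. u \<bullet> x = 0}"
  have u0: "u \<noteq> 0" "u \<in> V"
    using w u by (auto simp: dual_lattice_def)
  have "u \<notin> span ?W"
    using u0 by (subst span_eq_iff[THEN iffD2, OF kernel_subspace]) simp
  then have "dim (insert u ?W) = Suc (dim ?W)"
    by (simp add: dim_insert)
  moreover have "V \<subseteq> span (insert u ?W)"
  proof
    fix x assume x: "x \<in> V"
    have "x - ((u \<bullet> x) / (u \<bullet> u)) *\<^sub>R u \<in> ?W"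
      using x u0 V by (simp add: inner_simps subspace_diff subspace_scale)
    then have "x - ((u \<bullet> x) / (u \<bullet> u)) *\<^sub>R u \<in> span ?W"
      by (rule span_base)
    then show "x \<in> span (insert u ?W)"
      using span_breakdown_eq by blast
  qed
  then have "dim V \<le> dim (insert u ?W)"
    using dim_subset[of V "span (insert u ?W)"] by simp
  moreover have "dim (insert u ?W) \<le> dim V"
    using u0 by (intro dim_subset) auto
  ultimately show ?thesis
    by simp
qed

end

text \<open>Slice by the integer layer nearest the middle of a direction \<open>u\<close> of near-minimal width.
  If the slice were thin in a direction \<open>v\<close> then the body would be thin in the direction
  \<open>v - t u\<close> for some real \<open>t\<close>; rounding \<open>t\<close> costs only half the width along \<open>u\<close>.\<close>

theorem lattice_point_of_wide:
  fixes V \<Lambda> C :: "'a::euclidean_space set"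
  assumes "dim V = k" "subspace V"
    and "add_subgroup \<Lambda>" "\<Lambda> \<subseteq> V" "V \<subseteq> span \<Lambda>" "V \<subseteq> span (dual_lattice V \<Lambda>)"
    and "compact C" "convex C" "C \<noteq> {}" "C \<subseteq> V"
    and "\<forall>u\<in>dual_lattice V \<Lambda>. u \<noteq> 0 \<longrightarrow> (\<exists>x\<in>C. \<exists>y\<in>C. flatness_bound k \<le> u \<bullet> x - u \<bullet> y)"
  shows "\<exists>z\<in>C. z \<in> \<Lambda>"
  using assms
proof (induction k arbitrary: V \<Lambda> C)
  case 0
  then have "V \<subseteq> {0}"
    by (simp add: dim_eq_0)
  then have "C = {0}"
    using 0 by auto
  then show ?case
    using 0 by (simp add: add_subgroup_zero)
next
  case (Suc k)
  note V = Suc.prems(1,2) and \<Lambda> = Suc.prems(3-6) and C = Suc.prems(7-10) and wide = Suc.prems(11)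
  define M where "M = dual_lattice V \<Lambda>"
  have "\<exists>p\<in>C. \<forall>x\<in>C. u \<bullet> x \<le> u \<bullet> p" for u
    by (intro continuous_attains_sup C continuous_intros)
  then obtain P where P: "\<And>u. P u \<in> C" "\<And>u x. x \<in> C \<Longrightarrow> u \<bullet> x \<le> u \<bullet> P u"
    by metis
  define Q where "Q u = P (- u)" for u
  have Q: "Q u \<in> C" "x \<in> C \<Longrightarrow> u \<bullet> Q u \<le> u \<bullet> x" for u x
    using P(1)[of "- u"] P(2)[of x "- u"] by (auto simp: Q_def)
  define W where "W u = u \<bullet> P u - u \<bullet> Q u" for u
  have W_ge: "u \<bullet> x - u \<bullet> y \<le> W u" if "x \<in> C" "y \<in> C" for u x y
    using P(2)[OF that(1)] Q(2)[OF that(2)] by (simp add: W_def diff_mono)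
  have W_le: "W u \<le> s" if "\<And>x y. x \<in> C \<Longrightarrow> y \<in> C \<Longrightarrow> u \<bullet> x - u \<bullet> y \<le> s" for u s
    using that P(1) Q(1) by (simp add: W_def)
  have bound: "flatness_bound (Suc k) \<le> W u" if "u \<in> M - {0}" for u
  proof -
    have "\<exists>x\<in>C. \<exists>y\<in>C. flatness_bound (Suc k) \<le> u \<bullet> x - u \<bullet> y"
      using that by (intro wide[rule_format]) (auto simp: M_def)
    then show ?thesis
      using W_ge[of _ _ u] order_trans by blast
  qed
  have "M - {0} \<noteq> {}"
  proof
    assume "M - {0} = {}"
    then have "span M \<subseteq> {0}"
      using span_mono[of M "{0}"] by auto
    then have "dim V = 0"
      using \<Lambda>(4) by (auto simp: M_def)
    then show False
      using V by simp
  qed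
  then obtain u where u: "u \<in> M - {0}" and umin: "\<And>v. v \<in> M - {0} \<Longrightarrow> W u \<le> 3/2 * W v"
    by (rule obtain_near_minimiser[where f = W and c = "3/2"])
      (use bound flatness_bound_pos[of "Suc k"] in auto)
  have uM: "u \<in> dual_lattice V \<Lambda>" "u \<noteq> 0"
    using u by (auto simp: M_def)
  have fpos: "flatness_bound k > 0"
    by (rule flatness_bound_pos)
  have Wu: "W u \<ge> 36 * flatness_bound k + 3"
    using bound[OF u] by simp
  \<comment> \<open>Primitivity of \<open>u\<close>: dividing by \<open>m \<ge> 2\<close> at least
    halves the width, which the factor 3/2 of near-minimality, being less than 2, excludes.\<close>
  have "(1 / real m) *\<^sub>R u \<notin> dual_lattice V \<Lambda>" if "m \<ge> 2" for m :: nat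
  proof
    assume "(1 / real m) *\<^sub>R u \<in> dual_lattice V \<Lambda>"
    then have "W u \<le> 3/2 * W ((1 / real m) *\<^sub>R u)"
      using that u by (intro umin) (auto simp: M_def)
    moreover have "W ((1 / real m) *\<^sub>R u) \<le> W u / 2"
    proof (rule W_le)
      fix x y assume "x \<in> C" "y \<in> C"
      then have "u \<bullet> x - u \<bullet> y \<le> W u"
        by (rule W_ge)
      then have "(u \<bullet> x - u \<bullet> y) / real m \<le> W u / real m"
        using that by (simp add: divide_right_mono)
      also have "\<dots> \<le> W u / 2"
        using that Wu fpos by (intro divide_left_mono) auto
      finally show "((1 / real m) *\<^sub>R u) \<bullet> x - ((1 / real m) *\<^sub>R u) \<bullet> y \<le> W u / 2"
        by (simp add: diff_divide_distrib)
    qed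
    ultimately show False
      using Wu fpos by linarith
  qed
  then obtain w where w: "w \<in> \<Lambda>" "u \<bullet> w = 1"
    using obtain_unit_pairing[OF \<Lambda>(1) V(2) \<Lambda>(3) uM] by blast
  define p q where "p = P u" and "q = Q u"
  have pq: "p \<in> C" "q \<in> C" "W u = u \<bullet> p - u \<bullet> q"
    "\<And>x. x \<in> C \<Longrightarrow> u \<bullet> q \<le> u \<bullet> x \<and> u \<bullet> x \<le> u \<bullet> p"
    using P Q by (auto simp: p_def q_def W_def)
  \<comment> \<open>Rounding moves the midpoint by at most 1/2. Since the width is at least 3, this
    is at most a sixth of it, so the layer stays in the middle third.\<close>
  define l where "l = real_of_int (round ((u \<bullet> p + u \<bullet> q) / 2))"
  have "\<bar>l - (u \<bullet> p + u \<bullet> q) / 2\<bar> \<le> 1/2"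
    unfolding l_def by (rule of_int_round_abs_le)
  then have l: "u \<bullet> q < l" "l < u \<bullet> p" "u \<bullet> p - l \<le> 2 * (l - u \<bullet> q)" "l - u \<bullet> q \<le> 2 * (u \<bullet> p - l)"
    using Wu fpos pq(3) by (auto simp: abs_le_iff field_simps)
  have lw: "l *\<^sub>R w \<in> \<Lambda>"
    using w \<Lambda> by (intro add_subgroup_scaleR) (auto simp: l_def)
  \<comment> \<open>Subtracting the lattice vector \<open>l w\<close> moves the slice into the
    kernel of \<open>u\<close>, where the induction hypothesis applies, without changing which of
    its points belong to the lattice.\<close>
  define D where "D = (\<lambda>x. x - l *\<^sub>R w) ` (C \<inter> {x. u \<bullet> x = l})"
  have D_conv: "convex D"
    unfolding D_def using C(2)
    by (intro convex_translation_subtract convex_Int convex_hyperplane)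
  have D_comp: "compact D"
    unfolding D_def using C(1)
    by (intro compact_translation_subtract compact_Int_closed closed_hyperplane)
  have D_ne: "D \<noteq> {}"
  proof -
    define \<mu> where "\<mu> = (l - u \<bullet> q) / (u \<bullet> p - u \<bullet> q)"
    have \<mu>: "0 \<le> \<mu>" "\<mu> \<le> 1" "\<mu> * (u \<bullet> p - u \<bullet> q) = l - u \<bullet> q"
      using l by (auto simp: \<mu>_def)
    have "(1 - \<mu>) *\<^sub>R q + \<mu> *\<^sub>R p \<in> C"
      using C(2) pq \<mu> by (intro convexD_alt) auto
    moreover have "u \<bullet> ((1 - \<mu>) *\<^sub>R q + \<mu> *\<^sub>R p) = l"
      using \<mu>(3) by (simp add: inner_simps algebra_simps)
    ultimately show ?thesis
      by (auto simp: D_def)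
  qed
  have D_sub: "D \<subseteq> V \<inter> {x. u \<bullet> x = 0}"
    using C(4) lw w \<Lambda>(2) V(2) by (auto simp: D_def inner_simps subspace_diff subsetD)
  have "\<exists>z\<in>D. z \<in> \<Lambda> \<inter> {x. u \<bullet> x = 0}"
  proof (rule Suc.IH[OF _ _ _ _ _ _ D_comp D_conv D_ne D_sub])
    note ctx = V(2) \<Lambda>(1,2) uM(1) w
    show "dim (V \<inter> {x. u \<bullet> x = 0}) = k"
      using kernel_dim[OF ctx] V(1) by simp
    show "subspace (V \<inter> {x. u \<bullet> x = 0})"
      by (rule kernel_subspace[OF ctx])
    show "add_subgroup (\<Lambda> \<inter> {x. u \<bullet> x = 0})"
      by (rule kernel_add_subgroup[OF ctx])
    show "\<Lambda> \<inter> {x. u \<bullet> x = 0} \<subseteq> V \<inter> {x. u \<bullet> x = 0}"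
      using \<Lambda>(2) by auto
    show "V \<inter> {x. u \<bullet> x = 0} \<subseteq> span (\<Lambda> \<inter> {x. u \<bullet> x = 0})"
      by (rule kernel_span[OF ctx \<Lambda>(3)])
    show "V \<inter> {x. u \<bullet> x = 0}
        \<subseteq> span (dual_lattice (V \<inter> {x. u \<bullet> x = 0}) (\<Lambda> \<inter> {x. u \<bullet> x = 0}))"
      by (rule kernel_span_dual[OF ctx \<Lambda>(4)])
    show "\<forall>v\<in>dual_lattice (V \<inter> {x. u \<bullet> x = 0}) (\<Lambda> \<inter> {x. u \<bullet> x = 0}).
        v \<noteq> 0 \<longrightarrow> (\<exists>x\<in>D. \<exists>y\<in>D. flatness_bound k \<le> v \<bullet> x - v \<bullet> y)"
    proof (intro ballI impI)
      fix v assume v: "v \<in> dual_lattice (V \<inter> {x. u \<bullet> x = 0}) (\<Lambda> \<inter> {x. u \<bullet> x = 0})" "v \<noteq> 0"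
      define v' where "v' = v - (v \<bullet> w) *\<^sub>R u"
      have v': "v' \<in> dual_lattice V \<Lambda>"
        unfolding v'_def by (rule kernel_dual_extend[OF ctx v(1)])
      have uv: "u \<bullet> v = 0"
        using v(1) by (simp add: dual_lattice_def)
      show "\<exists>x\<in>D. \<exists>y\<in>D. flatness_bound k \<le> v \<bullet> x - v \<bullet> y"
      proof (rule ccontr)
        assume "\<not> ?thesis"
        then have thin: "v \<bullet> x - v \<bullet> y \<le> flatness_bound k" if "x \<in> D" "y \<in> D" for x y
          using that by force
        have "\<forall>x\<in>C. \<forall>y\<in>C. u \<bullet> x = l \<longrightarrow> u \<bullet> y = l \<longrightarrow> v' \<bullet> x - v' \<bullet> y \<le> flatness_bound k"
        proof (intro ballI impI)
          fix x y assume xy: "x \<in> C" "y \<in> C" "u \<bullet> x = l" "u \<bullet> y = l"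
          then have "x - l *\<^sub>R w \<in> D" "y - l *\<^sub>R w \<in> D"
            by (auto simp: D_def)
          from thin[OF this] show "v' \<bullet> x - v' \<bullet> y \<le> flatness_bound k"
            using xy by (simp add: v'_def inner_simps)
        qed
        then obtain t where t: "\<And>x y. x \<in> C \<Longrightarrow> y \<in> C \<Longrightarrow>
            (v' - t *\<^sub>R u) \<bullet> x - (v' - t *\<^sub>R u) \<bullet> y \<le> 6 * flatness_bound k"
          using width_le_of_section[OF C(2) pq(1,2,4) l] by blast
        \<comment> \<open>The real multiple \<open>t\<close> need not give a dual vector, but the
          integer \<open>m\<close> does. The result is nonzero because \<open>v\<close> is
          orthogonal to \<open>u\<close>.\<close>
        define m where "m = real_of_int (round t)"
        define v'' where "v'' = v' - m *\<^sub>R u"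
        have "v'' \<in> M - {0}"
        proof
          show "v'' \<in> M"
            using v' uM(1) V(2)
            by (auto simp: v''_def M_def dual_lattice_def inner_simps m_def subspace_diff subspace_scale)
          have "v \<bullet> v'' = v \<bullet> v"
            using uv by (simp add: v''_def v'_def inner_simps inner_commute[of v u])
          then show "v'' \<notin> {0}"
            using v(2) by auto
        qed
        from umin[OF this] have "W u \<le> 3/2 * W v''" .
        moreover have "W v'' \<le> 6 * flatness_bound k + W u / 2"
        proof (rule W_le)
          fix x y assume xy: "x \<in> C" "y \<in> C"
          have "\<bar>u \<bullet> x - u \<bullet> y\<bar> \<le> W u"
            using W_ge[OF xy] W_ge[OF xy(2,1)] by (simp add: abs_le_iff)
          moreover have "\<bar>t - m\<bar> \<le> 1/2"
            using of_int_round_abs_le[of t] by (simp add: m_def abs_minus_commute)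
          ultimately have "\<bar>t - m\<bar> * \<bar>u \<bullet> x - u \<bullet> y\<bar> \<le> 1/2 * W u"
            by (intro mult_mono) auto
          then have "(t - m) * (u \<bullet> x - u \<bullet> y) \<le> W u / 2"
            by (simp add: abs_mult[symmetric])
          moreover have "v'' \<bullet> x - v'' \<bullet> y
              = ((v' - t *\<^sub>R u) \<bullet> x - (v' - t *\<^sub>R u) \<bullet> y) + (t - m) * (u \<bullet> x - u \<bullet> y)"
            by (simp add: v''_def inner_simps algebra_simps)
          ultimately show "v'' \<bullet> x - v'' \<bullet> y \<le> 6 * flatness_bound k + W u / 2"
            using t[OF xy] by linarith
        qed
        ultimately show False
          using Wu fpos by linarith
      qed
    qed
  qed
  then obtain x where "x \<in> C" "x - l *\<^sub>R w \<in> \<Lambda>"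
    by (auto simp: D_def)
  then have "x \<in> \<Lambda>"
    using add_subgroup_add[OF \<Lambda>(1) _ lw] by fastforce
  then show ?case
    using \<open>x \<in> C\<close> by blast
qed

section \<open>Lattice points and lattice width\<close>

lemma add_subgroup_lattice_points: "add_subgroup (lattice_points :: (real^'n) set)"
  by (simp add: add_subgroup_def lattice_points_def)

lemma axis_in_lattice_points: "axis i 1 \<in> lattice_points"
  by (simp add: lattice_points_def axis_def)

lemma span_lattice_points: "span (lattice_points :: (real^'n) set) = UNIV"
proof -
  have "span (Basis :: (real^'n) set) \<subseteq> span lattice_points"
    by (intro span_mono) (auto simp: Basis_vec_def axis_in_lattice_points)
  then show ?thesis
    by auto
qed

lemma dual_lattice_points: "dual_lattice UNIV (lattice_points :: (real^'n) set) = lattice_points"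
proof -
  have "u \<bullet> z \<in> \<int>" if "u \<in> lattice_points" "z \<in> lattice_points" for u z :: "real^'n"
    using that by (auto simp: inner_vec_def lattice_points_def)
  moreover have "u \<in> lattice_points" if "\<And>z. z \<in> lattice_points \<Longrightarrow> u \<bullet> z \<in> \<int>" for u :: "real^'n"
    using that[OF axis_in_lattice_points] by (simp add: lattice_points_def inner_axis)
  ultimately show ?thesis
    by (auto simp: dual_lattice_def)
qed

lemma norm_lattice_point_ge_1:
  assumes "u \<in> lattice_points" "u \<noteq> 0"
  shows "1 \<le> norm u"
proof -
  obtain i where "u $ i \<noteq> 0"
    using assms(2) by (auto simp: vec_eq_iff)
  then have "1 \<le> \<bar>u $ i\<bar>"
    using assms(1) by (intro Ints_nonzero_abs_ge1) (auto simp: lattice_points_def)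
  then show ?thesis
    using component_le_norm_cart[of u i] by linarith
qed

text \<open>Distinct lattice points are at distance at least 1. Arbitrary subsets are allowed
  because the lattice points inside a subspace and those outside it are later treated
  separately.\<close>

lemma closed_subset_lattice_points:
  assumes "S \<subseteq> lattice_points"
  shows "closed S"
proof (rule discrete_imp_closed)
  show "\<forall>x\<in>S. \<forall>y\<in>S. dist y x < 1 \<longrightarrow> y = x"
  proof (intro ballI impI)
    fix x y assume "x \<in> S" "y \<in> S" "dist y x < 1"
    moreover from this have "y - x \<in> lattice_points"
      using assms add_subgroup_lattice_points by (intro add_subgroup_diff) auto
    ultimately show "y = x"
      using norm_lattice_point_ge_1[of "y - x"] by (fastforce simp: dist_norm)
  qed
qed simp

lemma finite_lattice_points_Int_cball: "finite (cball (0 :: real^'n) r \<inter> lattice_points)"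
proof -
  have "\<not> x islimpt lattice_points" for x :: "real^'n"
  proof -
    have "closed (lattice_points - {x})"
      by (rule closed_subset_lattice_points) auto
    then show ?thesis
      by (subst islimpt_punctured) (auto simp: closed_limpt)
  qed
  then show ?thesis
    by (intro finite_not_islimpt_in_compact) auto
qed

section \<open>Lattice width and finiteness of the flatness constant\<close>

lemma width_dir_ge:
  assumes "compact K" "x \<in> K" "y \<in> K"
  shows "\<bar>u \<bullet> x - u \<bullet> y\<bar> \<le> width_dir u K"
proof -
  obtain B where B: "\<And>x. x \<in> K \<Longrightarrow> norm x \<le> B"
    using compact_imp_bounded[OF assms(1)] by (auto simp: bounded_iff)
  have "bdd_above {\<bar>u \<bullet> x - u \<bullet> y\<bar> | x y. x \<in> K \<and> y \<in> K}"
  proof (rule bdd_aboveI, clarify)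
    fix x y assume "x \<in> K" "y \<in> K"
    then have "norm (x - y) \<le> 2 * B"
      using B[of x] B[of y] norm_triangle_ineq4[of x y] by linarith
    then show "\<bar>u \<bullet> x - u \<bullet> y\<bar> \<le> norm u * (2 * B)"
      using Cauchy_Schwarz_ineq2[of u "x - y"] mult_left_mono[of "norm (x - y)" "2 * B" "norm u"]
      by (simp add: inner_diff_right)
  qed
  then show ?thesis
    unfolding width_dir_def using assms(2,3) by (intro cSup_upper) auto
qed

lemma width_dir_le:
  assumes "K \<noteq> {}" "\<And>x y. x \<in> K \<Longrightarrow> y \<in> K \<Longrightarrow> \<bar>u \<bullet> x - u \<bullet> y\<bar> \<le> s"
  shows "width_dir u K \<le> s"
  unfolding width_dir_def using assms by (intro cSup_least) blast+

lemma lattice_width_le: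
  assumes "compact K" "K \<noteq> {}" "u \<in> lattice_points" "u \<noteq> 0"
  shows "lattice_width K \<le> width_dir u K"
proof -
  obtain x where x: "x \<in> K"
    using assms(2) by blast
  have "bdd_below {width_dir u K | u. u \<in> lattice_points \<and> u \<noteq> 0}"
    by (rule bdd_belowI[of _ 0]) (use width_dir_ge[OF assms(1) x x] in auto)
  then show ?thesis
    unfolding lattice_width_def using assms(3,4) by (intro cInf_lower) auto
qed

lemma le_lattice_width:
  fixes K :: "(real^'n) set"
  assumes "\<And>u. u \<in> lattice_points \<Longrightarrow> u \<noteq> 0 \<Longrightarrow> s \<le> width_dir u K"
  shows "s \<le> lattice_width K"
proof -
  \<comment> \<open>Here \<open>undefined\<close> is just some index. A nonzero lattice vector
    ensures that the infimum is not taken over the empty set.\<close>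
  have "axis undefined 1 \<noteq> (0 :: real^'n)"
    by (simp add: axis_eq_0_iff)
  then have "{width_dir u K | u. u \<in> lattice_points \<and> u \<noteq> 0} \<noteq> {}"
    using axis_in_lattice_points by blast
  then show ?thesis
    unfolding lattice_width_def using assms by (intro cInf_greatest) auto
qed

lemma hollow_lattice_width_le:
  fixes K :: "(real^'n) set"
  assumes K: "convex_body K" "K \<inter> lattice_points = {}"
  shows "lattice_width K \<le> flatness_bound CARD('n)"
proof (rule ccontr)
  assume *: "\<not> ?thesis"
  have "\<exists>z\<in>K. z \<in> lattice_points"
  proof (rule lattice_point_of_wide[of UNIV "CARD('n)" lattice_points K])
    show "\<forall>u\<in>dual_lattice UNIV lattice_points. u \<noteq> 0 \<longrightarrow>
        (\<exists>x\<in>K. \<exists>y\<in>K. flatness_bound CARD('n) \<le> u \<bullet> x - u \<bullet> y)"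
    proof (intro ballI impI)
      fix u :: "real^'n" assume u: "u \<in> dual_lattice UNIV lattice_points" "u \<noteq> 0"
      show "\<exists>x\<in>K. \<exists>y\<in>K. flatness_bound CARD('n) \<le> u \<bullet> x - u \<bullet> y"
      proof (rule ccontr)
        assume "\<not> ?thesis"
        then have thin: "\<And>x y. x \<in> K \<Longrightarrow> y \<in> K \<Longrightarrow> u \<bullet> x - u \<bullet> y \<le> flatness_bound CARD('n)"
          by force
        have "width_dir u K \<le> flatness_bound CARD('n)"
        proof (rule width_dir_le)
          fix x y assume "x \<in> K" "y \<in> K"
          then show "\<bar>u \<bullet> x - u \<bullet> y\<bar> \<le> flatness_bound CARD('n)"
            using thin[of x y] thin[of y x] by linarith
        qed (use K in \<open>simp add: convex_body_def\<close>)
        moreover have "lattice_width K \<le> width_dir u K"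
          using K u by (intro lattice_width_le) (auto simp: convex_body_def dual_lattice_points)
        ultimately show False
          using * by linarith
      qed
    qed
  qed (use K in \<open>simp_all add: convex_body_def add_subgroup_lattice_points span_lattice_points dual_lattice_points\<close>)
  then show False
    using K by blast
qed

text \<open>The explicit bound of the flatness theorem shows that the set of widths is bounded
  above, so the \<open>Sup\<close> defining \<open>Flt\<close> really is an upper bound.\<close>

lemma hollow_lattice_width_le_Flt:
  fixes K :: "(real^'n) set"
  assumes "convex_body K" "K \<inter> lattice_points = {}"
  shows "lattice_width K \<le> Flt TYPE('n)"
  unfolding Flt_def
proof (rule cSup_upper)
  show "bdd_above {lattice_width K |K :: (real^'n) set. convex_body K \<and> K \<inter> lattice_points = {}}"
    by (rule bdd_aboveI[of _ "flatness_bound CARD('n)"]) (use hollow_lattice_width_le in blast)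
qed (use assms in blast)

text \<open>Thickening a hollow translate by a small ball increases its width, so the inequality
  between \<open>Flt\<close> and the width need not be strict.\<close>

lemma translate_meets_lattice:
  fixes K :: "(real^'n) set"
  assumes K: "convex_body K" and r: "0 < r"
    and wide: "Flt TYPE('n) * r \<le> lattice_width K"
  shows "\<exists>c\<in>(\<lambda>x. (1 / r) *\<^sub>R x) ` K. t + c \<in> lattice_points"
proof (rule ccontr)
  assume *: "\<not> ?thesis"
  define D where "D = (\<lambda>x. t + x) ` (\<lambda>x. (1 / r) *\<^sub>R x) ` K"
  have D: "compact D" "convex D"
    unfolding D_def using K
    by (auto simp: convex_body_def intro!: compact_translation compact_scaling convex_translation convex_scaling)
  have "D \<inter> lattice_points = {}"
    using * by (auto simp: D_def)
  then obtain d where d: "d > 0" "\<And>x y. x \<in> D \<Longrightarrow> y \<in> lattice_points \<Longrightarrow> d \<le> dist x y"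
    using separate_compact_closed[OF D(1) closed_subset_lattice_points[OF order_refl]] by blast
  \<comment> \<open>A radius below the distance \<open>d\<close> keeps the thickened body free of
    lattice points.\<close>
  define \<epsilon> where "\<epsilon> = d / 2"
  define E where "E = {x + y | x y. x \<in> D \<and> y \<in> cball 0 \<epsilon>}"
  have EI: "x + y \<in> E" if "x \<in> D" "norm y \<le> \<epsilon>" for x y
    using that by (auto simp: E_def)
  have E: "convex_body E"
    unfolding convex_body_def
  proof (intro conjI)
    show "compact E"
      unfolding E_def by (rule compact_sums[OF D(1) compact_cball])
    have "E = (\<Union>x\<in>D. \<Union>y\<in>cball 0 \<epsilon>. {x + y})"
      unfolding E_def by blast
    then show "convex E"
      using convex_sums[OF D(2) convex_cball] by simp
    show "E \<noteq> {}"
      using EI[of _ 0] K d(1) by (auto simp: D_def convex_body_def \<epsilon>_def)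
  qed
  have "E \<inter> lattice_points = {}"
  proof (rule ccontr)
    assume "E \<inter> lattice_points \<noteq> {}"
    then obtain x y where "x \<in> D" "norm y \<le> \<epsilon>" "x + y \<in> lattice_points"
      by (auto simp: E_def)
    then show False
      using d by (force simp: \<epsilon>_def dist_norm dest: d(2))
  qed
  from hollow_lattice_width_le_Flt[OF E this]
  have "lattice_width E \<le> Flt TYPE('n)" .
  moreover have "lattice_width K / r + \<epsilon> \<le> lattice_width E"
  proof (rule le_lattice_width)
    fix u :: "real^'n" assume u: "u \<in> lattice_points" "u \<noteq> 0"
    have "width_dir u K \<le> r * (width_dir u E - \<epsilon>)"
    proof (rule width_dir_le)
      show "K \<noteq> {}"
        using K by (simp add: convex_body_def)
      fix x y assume xy: "x \<in> K" "y \<in> K"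
      have half: "u \<bullet> x - u \<bullet> y \<le> r * (width_dir u E - \<epsilon>)" if xy: "x \<in> K" "y \<in> K" for x y
      proof -
        \<comment> \<open>Shifting one endpoint by length \<open>\<epsilon>\<close> in the direction
          of \<open>u\<close> raises \<open>u\<close> by \<open>\<epsilon> * norm u\<close>, which
          is at least \<open>\<epsilon>\<close> for a nonzero lattice vector. The gain is thus
          uniform in \<open>u\<close> and survives the infimum.\<close>
        define e where "e = (\<epsilon> / norm u) *\<^sub>R u"
        have "norm e = \<epsilon>"
          using u d by (simp add: e_def \<epsilon>_def)
        moreover have "t + (1 / r) *\<^sub>R x \<in> D" "t + (1 / r) *\<^sub>R y \<in> D"
          using xy unfolding D_def by blast+
        ultimately have "(t + (1 / r) *\<^sub>R x) + e \<in> E" "(t + (1 / r) *\<^sub>R y) + 0 \<in> E"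
          using EI[of _ e] EI[of _ 0] d(1) by (simp_all add: \<epsilon>_def del: add_0_right)
        from width_dir_ge[OF _ this, of u]
        have "u \<bullet> ((t + (1 / r) *\<^sub>R x) + e) - u \<bullet> ((t + (1 / r) *\<^sub>R y) + 0) \<le> width_dir u E"
          using E by (simp add: convex_body_def)
        moreover have "u \<bullet> e \<ge> \<epsilon>"
        proof -
          have "u \<bullet> e = \<epsilon> * norm u"
            using u by (simp add: e_def dot_square_norm power2_eq_square)
          then show ?thesis
            using norm_lattice_point_ge_1[OF u] d by (simp add: \<epsilon>_def)
        qed
        ultimately have "(u \<bullet> x - u \<bullet> y) / r \<le> width_dir u E - \<epsilon>"
          by (simp add: inner_simps diff_divide_distrib)
        then show ?thesis
          using r by (simp add: field_simps)
      qed
      show "\<bar>u \<bullet> x - u \<bullet> y\<bar> \<le> r * (width_dir u E - \<epsilon>)"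
        using half[OF xy] half[OF xy(2,1)] by linarith
    qed
    moreover have "lattice_width K \<le> width_dir u K"
      using K u by (intro lattice_width_le) (auto simp: convex_body_def)
    ultimately have "lattice_width K \<le> r * (width_dir u E - \<epsilon>)"
      by linarith
    then show "lattice_width K / r + \<epsilon> \<le> width_dir u E"
      using r by (simp add: field_simps)
  qed
  moreover have "Flt TYPE('n) \<le> lattice_width K / r"
    using wide r by (simp add: field_simps)
  ultimately show False
    using d(1) by (simp add: \<epsilon>_def)
qed

section \<open>Lattice bases from difference vectors\<close>

text \<open>The covering property writes every point as \<open>z - c\<close> with \<open>z\<close> a
  lattice point and \<open>c\<close> in \<open>C\<close>. Sorting by whether \<open>z\<close> lies
  in \<open>L\<close> covers the space by two nonempty closed sets, which meet by connectedness. At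
  a common point \<open>z - c = z' - c'\<close>, the difference \<open>c' - c = z' - z\<close> is as
  required.\<close>

lemma difference_outside_subspace:
  fixes C :: "(real^'n) set"
  assumes C: "compact C" and cov: "\<And>t. \<exists>c\<in>C. t + c \<in> lattice_points"
    and L: "subspace L" "L \<noteq> UNIV"
  obtains x y where "x \<in> C" "y \<in> C" "x - y \<in> lattice_points" "x - y \<notin> L"
proof -
  define A where "A = (\<Union>z\<in>lattice_points \<inter> L. \<Union>c\<in>C. {z - c})"
  define B where "B = (\<Union>z\<in>lattice_points - L. \<Union>c\<in>C. {z - c})"
  have "closed A"
    unfolding A_def by (rule closed_compact_differences[OF closed_subset_lattice_points C]) auto
  moreover have "closed B"
    unfolding B_def by (rule closed_compact_differences[OF closed_subset_lattice_points C]) auto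
  moreover have "UNIV \<subseteq> A \<union> B"
  proof
    fix t :: "real^'n"
    obtain c where "c \<in> C" "t + c \<in> lattice_points"
      using cov by blast
    moreover have "t = (t + c) - c"
      by simp
    ultimately show "t \<in> A \<union> B"
      unfolding A_def B_def by (cases "t + c \<in> L") blast+
  qed
  moreover have "C \<noteq> {}"
    using cov by blast
  then have "A \<noteq> {}"
    unfolding A_def using add_subgroup_zero[OF add_subgroup_lattice_points] subspace_0[OF L(1)] by blast
  moreover have "\<not> lattice_points \<subseteq> L"
    using L span_minimal[of lattice_points L] span_lattice_points by auto
  then have "B \<noteq> {}"
    unfolding B_def using \<open>C \<noteq> {}\<close> by blast
  ultimately have "A \<inter> B \<noteq> {}"
    using connected_UNIV[where 'a = "real^'n"] unfolding connected_closed by auto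
  then obtain z c z' c' where *: "z \<in> lattice_points" "z \<in> L" "z' \<in> lattice_points" "z' \<notin> L"
      "c \<in> C" "c' \<in> C" "z - c = z' - c'"
    unfolding A_def B_def by blast
  then have "c' - c = z' - z"
    by (simp add: algebra_simps)
  moreover have "z' - z \<in> lattice_points"
    using * add_subgroup_lattice_points by (intro add_subgroup_diff)
  moreover have "z' - z \<notin> L"
    using * subspace_add[OF L(1), of "z' - z" z] by auto
  ultimately show ?thesis
    using that * by metis
qed

text \<open>For \<open>a\<close> outside \<open>L\<close>, this is the image modulo \<open>L\<close>
  of the lattice points of \<open>L + \<real> a\<close>, read in the coordinate along
  \<open>a\<close>.\<close>

definition coset_multiples :: "(real^'n) set \<Rightarrow> real^'n \<Rightarrow> real set" where
  "coset_multiples L a = {s. \<exists>l\<in>L. s *\<^sub>R a + l \<in> lattice_points}"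

text \<open>Because \<open>P\<close> covers \<open>L\<close> modulo the lattice, every multiple in
  (0,1] is realised by a lattice vector \<open>s a + p\<close> with \<open>p\<close> in the bounded
  set \<open>P\<close>. Only finitely many such vectors exist, so the group of multiples has a least
  positive element, and this generates it. It is at most 1, since \<open>a\<close> itself is a
  lattice vector.\<close>

lemma obtain_coset_generator:
  fixes a :: "real^'n"
  assumes L: "subspace L" "a \<in> lattice_points" "a \<notin> L"
    and P: "bounded P" "\<And>l. l \<in> L \<Longrightarrow> \<exists>p\<in>P \<inter> L. l - p \<in> lattice_points"
  obtains s where "0 < s" "s \<le> 1" "s \<in> coset_multiples L a"
    "\<And>r. r \<in> coset_multiples L a \<Longrightarrow> r / s \<in> \<int>"
proof -
  define G where "G = coset_multiples L a"
  obtain B where B: "\<And>p. p \<in> P \<Longrightarrow> norm p \<le> B"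
    using P(1) by (auto simp: bounded_iff)
  define F :: "(real^'n) set" where "F = cball 0 (norm a + B) \<inter> lattice_points"
  have "finite F"
    unfolding F_def by (rule finite_lattice_points_Int_cball)
  \<comment> \<open>A vector has at most one coordinate along \<open>a\<close> modulo
    \<open>L\<close>, as \<open>a\<close> is outside \<open>L\<close>.\<close>
  moreover have "finite {s. z - s *\<^sub>R a \<in> L}" for z
  proof (cases "\<exists>s. z - s *\<^sub>R a \<in> L")
    case True
    then obtain s where s: "z - s *\<^sub>R a \<in> L"
      by blast
    have "r = s" if "z - r *\<^sub>R a \<in> L" for r
    proof (rule ccontr)
      assume "r \<noteq> s"
      have "(1 / (s - r)) *\<^sub>R ((z - r *\<^sub>R a) - (z - s *\<^sub>R a)) \<in> L"
        by (rule subspace_scale[OF L(1) subspace_diff[OF L(1) that s]])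
      also have "(z - r *\<^sub>R a) - (z - s *\<^sub>R a) = (s - r) *\<^sub>R a"
        by (simp add: algebra_simps)
      finally show False
        using L(3) \<open>r \<noteq> s\<close> by simp
    qed
    then have "{s. z - s *\<^sub>R a \<in> L} \<subseteq> {s}"
      by blast
    then show ?thesis
      by (rule finite_subset) simp
  qed auto
  moreover have "G \<inter> {0<..1} \<subseteq> (\<Union>z\<in>F. {s. z - s *\<^sub>R a \<in> L})"
  proof
    fix s assume s: "s \<in> G \<inter> {0<..1}"
    then obtain l where l: "l \<in> L" "s *\<^sub>R a + l \<in> lattice_points"
      by (auto simp: G_def coset_multiples_def)
    obtain p where p: "p \<in> P" "p \<in> L" "l - p \<in> lattice_points"
      using P(2)[OF l(1)] by blast
    have "(s *\<^sub>R a + l) - (l - p) \<in> lattice_points"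
      by (rule add_subgroup_diff[OF add_subgroup_lattice_points l(2) p(3)])
    then have "s *\<^sub>R a + p \<in> lattice_points"
      by simp
    moreover have "norm (s *\<^sub>R a + p) \<le> norm a + B"
    proof -
      have "norm (s *\<^sub>R a) \<le> norm a"
        using s by (simp add: mult_left_le_one_le)
      then show ?thesis
        using B[OF p(1)] norm_triangle_ineq[of "s *\<^sub>R a" p] by linarith
    qed
    ultimately show "s \<in> (\<Union>z\<in>F. {s. z - s *\<^sub>R a \<in> L})"
      using p(2) by (auto simp: F_def intro!: bexI[of _ "s *\<^sub>R a + p"])
  qed
  ultimately have fin: "finite (G \<inter> {0<..1})"
    by (meson finite_UN_I finite_subset)
  have one: "1 \<in> G \<inter> {0<..1}"
    using L subspace_0[OF L(1)] by (auto simp: G_def coset_multiples_def intro!: bexI[of _ 0])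
  define s where "s = Min (G \<inter> {0<..1})"
  have "s \<in> G \<inter> {0<..1}"
    unfolding s_def by (rule Min_in[OF fin]) (use one in blast)
  then have s: "s \<in> G" "0 < s" "s \<le> 1"
    by auto
  have min: "s \<le> r" if "r \<in> G" "0 < r" for r
  proof (cases "r \<le> 1")
    case True
    then show ?thesis
      using Min_le[OF fin, of r] that by (simp add: s_def)
  qed (use s in simp)
  have "r / s \<in> \<int>" if r: "r \<in> G" for r
  proof -
    \<comment> \<open>The remainder \<open>r - m * s\<close> is in the group and in [0,s), so it is
      zero by minimality of \<open>s\<close>.\<close>
    define m where "m = real_of_int \<lfloor>r / s\<rfloor>"
    obtain l l' where l: "l \<in> L" "r *\<^sub>R a + l \<in> lattice_points"
      "l' \<in> L" "s *\<^sub>R a + l' \<in> lattice_points"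
      using r s(1) by (auto simp: G_def coset_multiples_def)
    have "(r *\<^sub>R a + l) - m *\<^sub>R (s *\<^sub>R a + l') \<in> lattice_points"
      using l add_subgroup_lattice_points
      by (intro add_subgroup_diff add_subgroup_scaleR) (auto simp: m_def)
    also have "(r *\<^sub>R a + l) - m *\<^sub>R (s *\<^sub>R a + l') = (r - m * s) *\<^sub>R a + (l - m *\<^sub>R l')"
      by (simp add: algebra_simps)
    finally have "r - m * s \<in> G"
      using l L(1) by (auto simp: G_def coset_multiples_def intro!: bexI[of _ "l - m *\<^sub>R l'"] subspace_diff subspace_scale)
    moreover have "m \<le> r / s" "r / s < m + 1"
      by (simp_all add: m_def)
    then have "0 \<le> r - m * s" "r - m * s < s"
      using s by (simp_all add: field_simps)
    ultimately have "r - m * s = 0"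
      using min[of "r - m * s"] by fastforce
    then have "r / s = m"
      using s by simp
    then show ?thesis
      unfolding m_def by (metis Ints_of_int)
  qed
  then show ?thesis
    using that s unfolding G_def by blast
qed

section \<open>Parallelepipeds and inductive construction of an adapted basis\<close>

definition parallelepiped :: "nat \<Rightarrow> (nat \<Rightarrow> 'a::real_vector) \<Rightarrow> 'a set" where
  "parallelepiped k c = {\<Sum>j<k. \<tau> j *\<^sub>R c j | \<tau>. \<forall>j. 0 \<le> \<tau> j \<and> \<tau> j \<le> (1::real)}"

lemma parallelepiped_cong:
  assumes "\<And>j. j < k \<Longrightarrow> c j = c' j"
  shows "parallelepiped k c = parallelepiped k c'"
proof -
  have "(\<Sum>j<k. \<tau> j *\<^sub>R c j) = (\<Sum>j<k. \<tau> j *\<^sub>R c' j)" for \<tau>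
    using assms by (intro sum.cong) auto
  then show ?thesis
    by (simp add: parallelepiped_def)
qed

lemma parallelepiped_Suc:
  assumes "p \<in> parallelepiped k c" "0 \<le> s" "s \<le> 1"
  shows "p + s *\<^sub>R c k \<in> parallelepiped (Suc k) c"
proof -
  obtain \<tau> where \<tau>: "p = (\<Sum>j<k. \<tau> j *\<^sub>R c j)" "\<forall>j. 0 \<le> \<tau> j \<and> \<tau> j \<le> 1"
    using assms(1) by (auto simp: parallelepiped_def)
  have "p + s *\<^sub>R c k = (\<Sum>j<Suc k. (\<tau>(k := s)) j *\<^sub>R c j)"
    using \<tau>(1) by simp
  then show ?thesis
    unfolding parallelepiped_def using \<tau>(2) assms(2,3)
    by (intro CollectI exI[of _ "\<tau>(k := s)"]) auto
qed

lemma bounded_parallelepiped: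
  fixes c :: "nat \<Rightarrow> 'a::real_normed_vector"
  shows "bounded (parallelepiped k c)"
proof (rule boundedI)
  fix p assume "p \<in> parallelepiped k c"
  then obtain \<tau> where \<tau>: "p = (\<Sum>j<k. \<tau> j *\<^sub>R c j)" "\<forall>j. 0 \<le> \<tau> j \<and> \<tau> j \<le> 1"
    by (auto simp: parallelepiped_def)
  have "norm p \<le> (\<Sum>j<k. norm (\<tau> j *\<^sub>R c j))"
    unfolding \<tau>(1) by (rule norm_sum)
  also have "\<dots> \<le> (\<Sum>j<k. norm (c j))"
    using \<tau>(2) by (intro sum_mono) (simp add: mult_left_le_one_le)
  finally show "norm p \<le> (\<Sum>j<k. norm (c j))" .
qed

lemma parallelepiped_subset_subspace:
  assumes "subspace L" "\<And>j. j < k \<Longrightarrow> c j \<in> L"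
  shows "parallelepiped k c \<subseteq> L"
  using assms by (auto simp: parallelepiped_def intro!: subspace_sum subspace_scale)

text \<open>The parallelepiped spanned by the differences \<open>x j - y j\<close> covers the span of \<open>b\<close> modulo
  the lattice, since these differences agree with the lattice basis \<open>b\<close> up to a unipotent
  triangular change of coordinates.\<close>

definition adapted_basis ::
  "(real^'n) set \<Rightarrow> nat \<Rightarrow> (nat \<Rightarrow> real^'n) \<Rightarrow> (nat \<Rightarrow> real^'n) \<Rightarrow> (nat \<Rightarrow> real^'n) \<Rightarrow> bool" where
  "adapted_basis C k b x y \<longleftrightarrow>
    (\<forall>i<k. x i \<in> C \<and> y i \<in> C \<and> b i \<in> lattice_points \<and> x i - y i \<in> span (b ` {..<k})
      \<and> b i \<in> parallelepiped k (\<lambda>j. x j - y j)) \<and>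
    dim (b ` {..<k}) = k \<and>
    (\<forall>q\<in>lattice_points \<inter> span (b ` {..<k}). \<exists>m :: nat \<Rightarrow> int. q = (\<Sum>i<k. of_int (m i) *\<^sub>R b i)) \<and>
    (\<forall>l\<in>span (b ` {..<k}). \<exists>p\<in>parallelepiped k (\<lambda>j. x j - y j). l - p \<in> lattice_points)"

lemma adapted_basis_0: "adapted_basis C 0 b x y"
  by (auto simp: adapted_basis_def parallelepiped_def add_subgroup_zero[OF add_subgroup_lattice_points])

lemma adapted_basis_Suc:
  fixes C :: "(real^'n) set"
  assumes ab: "adapted_basis C k b x y" and k: "k < CARD('n)"
    and C: "compact C" "convex C" and cov: "\<And>t. \<exists>c\<in>C. t + c \<in> lattice_points"
  shows "\<exists>b x y. adapted_basis C (Suc k) b x y"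
proof -
  define L where "L = span (b ` {..<k})"
  define P where "P = parallelepiped k (\<lambda>j. x j - y j)"
  have ab_el: "x i \<in> C" "y i \<in> C" "b i \<in> lattice_points" "x i - y i \<in> L" "b i \<in> P" if "i < k" for i
    using ab that by (auto simp: adapted_basis_def L_def P_def)
  have ab_dim: "dim (b ` {..<k}) = k"
    using ab by (simp add: adapted_basis_def)
  have ab_gen: "\<exists>m :: nat \<Rightarrow> int. q = (\<Sum>i<k. of_int (m i) *\<^sub>R b i)" if "q \<in> lattice_points" "q \<in> L" for q
    using ab that by (auto simp: adapted_basis_def L_def)
  have ab_cov: "\<exists>p\<in>P. l - p \<in> lattice_points" if "l \<in> L" for l
    using ab that by (auto simp: adapted_basis_def L_def P_def)
  have L: "subspace L"
    by (simp add: L_def)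
  have PL: "P \<subseteq> L"
    unfolding P_def using ab_el(4) by (intro parallelepiped_subset_subspace L)
  have "L \<noteq> UNIV"
  proof
    assume "L = UNIV"
    then have "dim (b ` {..<k}) = CARD('n)"
      using dim_span[of "b ` {..<k}"] by (simp add: L_def)
    then show False
      using ab_dim k by simp
  qed
  then obtain x0 y0 where xy: "x0 \<in> C" "y0 \<in> C" "x0 - y0 \<in> lattice_points" "x0 - y0 \<notin> L"
    using difference_outside_subspace[OF C(1) cov L] by metis
  have "bounded P"
    by (simp add: P_def bounded_parallelepiped)
  moreover have "\<exists>p\<in>P \<inter> L. l - p \<in> lattice_points" if "l \<in> L" for l
    using ab_cov[OF that] PL by blast
  ultimately obtain s where s: "0 < s" "s \<le> 1" "s \<in> coset_multiples L (x0 - y0)"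
    "\<And>r. r \<in> coset_multiples L (x0 - y0) \<Longrightarrow> r / s \<in> \<int>"
    using obtain_coset_generator[OF L xy(3,4), of P] by metis
  \<comment> \<open>Modulo \<open>L\<close>, this vector generates the lattice points of
    \<open>L + \<real> c\<close>. Since \<open>s \<le> 1\<close>, convexity keeps it a difference of
    points of \<open>C\<close>.\<close>
  define c where "c = s *\<^sub>R (x0 - y0)"
  have cL: "c \<notin> L"
  proof
    assume "c \<in> L"
    then have "(1 / s) *\<^sub>R c \<in> L"
      by (rule subspace_scale[OF L])
    then show False
      using s xy by (simp add: c_def)
  qed
  obtain l0 where l0: "l0 \<in> L" "c + l0 \<in> lattice_points"
    using s(3) by (auto simp: coset_multiples_def c_def)
  obtain p0 where p0: "p0 \<in> P" "l0 - p0 \<in> lattice_points"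
    using ab_cov[OF l0(1)] by blast
  \<comment> \<open>The lattice vector in the coset \<open>c + L\<close> is chosen with its
    correction in \<open>P\<close>, so that \<open>w\<close> lies in the enlarged
    parallelepiped.\<close>
  define w where "w = p0 + c"
  have "(c + l0) - (l0 - p0) \<in> lattice_points"
    by (rule add_subgroup_diff[OF add_subgroup_lattice_points l0(2) p0(2)])
  then have w: "w \<in> lattice_points"
    by (simp add: w_def add.commute)
  have wc: "w - c \<in> L"
    using p0 PL by (auto simp: w_def)
  have wL: "w \<notin> L"
    using subspace_diff[OF L _ wc, of w] cL by auto
  define b' x' y' where "b' = b(k := w)" "x' = x(k := y0 + c)" "y' = y(k := y0)"
  note defs = b'_x'_y'_def
  define L' where "L' = span (b' ` {..<Suc k})"
  define P' where "P' = parallelepiped (Suc k) (\<lambda>j. x' j - y' j)"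
  have img: "b' ` {..<Suc k} = insert w (b ` {..<k})"
    by (auto simp: defs lessThan_Suc)
  have L'_iff: "q \<in> L' \<longleftrightarrow> (\<exists>r. q - r *\<^sub>R w \<in> L)" for q
    unfolding L'_def img L_def by (rule span_breakdown_eq)
  have LL': "L \<subseteq> L'"
    unfolding L_def L'_def img by (intro span_mono) auto
  have L': "subspace L'" "w \<in> L'"
    by (auto simp: L'_def img intro: span_base)
  have P'I: "p + r *\<^sub>R c \<in> P'" if "p \<in> P" "0 \<le> r" "r \<le> 1" for p r
  proof -
    have "P = parallelepiped k (\<lambda>j. x' j - y' j)"
      unfolding P_def by (rule parallelepiped_cong) (simp add: defs)
    then show ?thesis
      using parallelepiped_Suc[of p k "\<lambda>j. x' j - y' j" r] that by (simp add: P'_def defs)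
  qed
  have "adapted_basis C (Suc k) b' x' y'"
    unfolding adapted_basis_def L'_def[symmetric] P'_def[symmetric]
  proof (intro conjI allI impI ballI)
    fix i assume "i < Suc k"
    then consider "i < k" | "i = k"
      by linarith
    note cases = this
    have "c = (w - (w - c))"
      by simp
    then have "c \<in> L'"
      using L' wc LL' subspace_diff by (metis subsetD)
    then show "x' i - y' i \<in> L'"
      using cases ab_el(4)[of i] LL' by cases (auto simp: defs)
    have "y0 + c = (1 - s) *\<^sub>R y0 + s *\<^sub>R x0"
      by (simp add: c_def algebra_simps)
    then have "y0 + c \<in> C"
      using C(2) xy(1,2) s(1,2) by (simp add: convexD_alt)
    then show "x' i \<in> C"
      using cases ab_el(1)[of i] by cases (auto simp: defs)
    show "y' i \<in> C"
      using cases ab_el(2)[of i] xy(2) by cases (auto simp: defs)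
    show "b' i \<in> lattice_points"
      using cases ab_el(3)[of i] w by cases (auto simp: defs)
    show "b' i \<in> P'"
      using cases
    proof cases
      case 1
      then show ?thesis
        using P'I[of "b i" 0] ab_el(5)[of i] by (simp add: defs)
    next
      case 2
      then show ?thesis
        using P'I[OF p0(1), of 1] by (simp add: defs w_def)
    qed
  next
    show "dim (b' ` {..<Suc k}) = Suc k"
      using wL ab_dim by (simp add: img dim_insert L_def)
  next
    fix q assume q: "q \<in> lattice_points \<inter> L'"
    then obtain r where r: "q - r *\<^sub>R w \<in> L"
      by (auto simp: L'_iff)
    have "(q - r *\<^sub>R w) + r *\<^sub>R (w - c) \<in> L"
      using L r wc by (intro subspace_add subspace_scale)
    \<comment> \<open>Modulo \<open>L\<close>, \<open>w\<close> equals \<open>s (x0 - y0)\<close>,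
      so the coefficient \<open>r\<close> along \<open>w\<close> is the coefficient
      \<open>r * s\<close> along \<open>x0 - y0\<close>. The choice of \<open>s\<close> then makes
      \<open>r\<close> an integer.\<close>
    moreover have "(r * s) *\<^sub>R (x0 - y0) + ((q - r *\<^sub>R w) + r *\<^sub>R (w - c)) = q"
      by (simp add: c_def algebra_simps)
    then have "(r * s) *\<^sub>R (x0 - y0) + ((q - r *\<^sub>R w) + r *\<^sub>R (w - c)) \<in> lattice_points"
      using q by (metis IntD1)
    ultimately have "r * s \<in> coset_multiples L (x0 - y0)"
      unfolding coset_multiples_def by blast
    from s(4)[OF this] have "r \<in> \<int>"
      using s(1) by simp
    then obtain n :: int where n: "r = of_int n"
      by (auto elim: Ints_cases)
    have "q - r *\<^sub>R w \<in> lattice_points"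
      using q w \<open>r \<in> \<int>\<close> add_subgroup_lattice_points
      by (intro add_subgroup_diff add_subgroup_scaleR) auto
    then obtain m :: "nat \<Rightarrow> int" where m: "q - r *\<^sub>R w = (\<Sum>i<k. of_int (m i) *\<^sub>R b i)"
      using ab_gen r by blast
    have "q = (\<Sum>i<Suc k. of_int ((m(k := n)) i) *\<^sub>R b' i)"
      using m n by (simp add: defs algebra_simps)
    then show "\<exists>m :: nat \<Rightarrow> int. q = (\<Sum>i<Suc k. of_int (m i) *\<^sub>R b' i)"
      by blast
  next
    fix l assume "l \<in> L'"
    then obtain r where r: "l - r *\<^sub>R w \<in> L"
      by (auto simp: L'_iff)
    \<comment> \<open>Split \<open>r w\<close> into integer and fractional parts. The integer part
      is a lattice vector; in the fractional part \<open>w\<close> is exchanged for \<open>c\<close>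
      at the cost of an element of \<open>L\<close>, which \<open>P\<close> covers.\<close>
    have "(l - r *\<^sub>R w) + frac r *\<^sub>R (w - c) \<in> L"
      using L r wc by (intro subspace_add subspace_scale)
    from ab_cov[OF this]
    obtain p where p: "p \<in> P" "(l - r *\<^sub>R w) + frac r *\<^sub>R (w - c) - p \<in> lattice_points"
      by blast
    have "(l - r *\<^sub>R w) + frac r *\<^sub>R (w - c) - p + of_int \<lfloor>r\<rfloor> *\<^sub>R w \<in> lattice_points"
      using p(2) w add_subgroup_lattice_points
      by (intro add_subgroup_add add_subgroup_scaleR) auto
    also have "(l - r *\<^sub>R w) + frac r *\<^sub>R (w - c) - p + of_int \<lfloor>r\<rfloor> *\<^sub>R w = l - (p + frac r *\<^sub>R c)"
      by (simp add: frac_def algebra_simps)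
    finally show "\<exists>p\<in>P'. l - p \<in> lattice_points"
      using P'I[OF p(1), of "frac r"] frac_lt_1[of r] by (auto simp: less_imp_le)
  qed
  then show ?thesis
    by blast
qed

lemma ex_adapted_basis:
  fixes C :: "(real^'n) set"
  assumes "compact C" "convex C" "\<And>t. \<exists>c\<in>C. t + c \<in> lattice_points"
  shows "\<exists>b x y. adapted_basis C CARD('n) b x y"
proof -
  have "k \<le> CARD('n) \<Longrightarrow> \<exists>b x y. adapted_basis C k b x y" for k
  proof (induction k)
    case 0
    then show ?case
      using adapted_basis_0 by blast
  next
    case (Suc k)
    then show ?case
      using adapted_basis_Suc[OF _ _ assms] by (metis Suc_le_lessD less_imp_le)
  qed
  then show ?thesis
    by blast
qed

section \<open>Unimodular simplices\<close>

text \<open>Expressing the unit vectors through \<open>b\<close> gives an integer right inverse of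
  the matrix with columns \<open>b\<close>, so its determinant is a divisor of 1 among the
  integers.\<close>

lemma unimodular_matrix_columns:
  fixes b :: "'n \<Rightarrow> real^'n"
  assumes int: "\<And>j. b j \<in> lattice_points"
    and gen: "\<And>q. q \<in> lattice_points \<Longrightarrow> \<exists>m :: 'n \<Rightarrow> int. q = (\<Sum>j\<in>UNIV. of_int (m j) *\<^sub>R b j)"
  shows "unimodular_matrix (\<chi> i j. b j $ i)"
proof -
  define A :: "real^'n^'n" where "A = (\<chi> i j. b j $ i)"
  have det_int: "det X \<in> \<int>" if "\<And>i j. X $ i $ j \<in> \<int>" for X :: "real^'n^'n"
    unfolding det_def using that by (intro Ints_sum Ints_mult Ints_prod) auto
  have A_int: "A $ i $ j \<in> \<int>" for i j
    using int[of j] by (simp add: A_def lattice_points_def)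
  have "\<forall>j. \<exists>m :: 'n \<Rightarrow> int. axis j 1 = (\<Sum>i\<in>UNIV. of_int (m i) *\<^sub>R b i)"
    using gen axis_in_lattice_points by blast
  then obtain m :: "'n \<Rightarrow> 'n \<Rightarrow> int"
    where m: "\<And>j. axis j 1 = (\<Sum>i\<in>UNIV. of_int (m j i) *\<^sub>R b i)"
    by metis
  define B :: "real^'n^'n" where "B = (\<chi> i j. of_int (m j i))"
  have "(A ** B) $ i $ j = mat 1 $ i $ j" for i j
  proof -
    have "(axis j (1::real) :: real^'n) $ i = (\<Sum>k\<in>UNIV. of_int (m j k) *\<^sub>R b k) $ i"
      by (subst m) simp
    then show ?thesis
      by (simp add: matrix_matrix_mult_def mat_def A_def B_def axis_def mult.commute)
  qed
  then have "A ** B = mat 1"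
    by (simp add: vec_eq_iff)
  then have "det A * det B = 1"
    by (metis det_mul det_I)
  moreover obtain a b where "det A = of_int a" "det B = of_int b"
    using det_int[of A] det_int[of B] A_int by (auto simp: B_def elim!: Ints_cases)
  ultimately have "a * b = 1"
    by (metis of_int_eq_1_iff of_int_mult)
  then have "a = 1 \<or> a = -1"
    by (auto simp: zmult_eq_1_iff)
  then show ?thesis
    using A_int \<open>det A = of_int a\<close> unfolding A_def unimodular_matrix_def by auto
qed

lemma affine_image_std_simplex_subset:
  fixes A :: "real^'n^'n"
  assumes "convex K" "p \<in> K" "\<And>i. column i A + p \<in> K"
  shows "(\<lambda>x. A *v x + p) ` std_simplex \<subseteq> K"
proof -
  have "std_simplex \<subseteq> {x. A *v x + p \<in> K}"
    unfolding std_simplex_def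
  proof (rule hull_minimal)
    show "insert 0 {axis i 1 | i. True} \<subseteq> {x. A *v x + p \<in> K}"
      using assms(2,3) by (auto simp: matrix_vector_mult_basis)
    show "convex {x. A *v x + p \<in> K}"
    proof (rule convexI, clarify)
      fix x y and s t :: real
      assume *: "A *v x + p \<in> K" "A *v y + p \<in> K" "0 \<le> s" "0 \<le> t" "s + t = 1"
      then have "s *\<^sub>R (A *v x + p) + t *\<^sub>R (A *v y + p) \<in> K"
        using assms(1) by (intro convexD) auto
      moreover have "s *\<^sub>R (A *v x + p) + t *\<^sub>R (A *v y + p)
          = A *v (s *\<^sub>R x + t *\<^sub>R y) + (s + t) *\<^sub>R p"
        by (simp add: matrix_vector_right_distrib matrix_vector_mult_scaleR algebra_simps)
      ultimately show "A *v (s *\<^sub>R x + t *\<^sub>R y) + p \<in> K"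
        using *(5) by simp
    qed
  qed
  then show ?thesis
    by auto
qed

text \<open>A sum of \<open>d\<close> points of \<open>C = K / d\<close> lies in \<open>K\<close>.
  With \<open>p\<close> the sum of all \<open>y j\<close>, adding a point of the parallelepiped
  replaces each \<open>y j\<close> by a point on the segment from \<open>y j\<close> to
  \<open>x j\<close>. The matrix and \<open>p\<close> are returned separately so that the simplex
  can be translated further.\<close>

lemma contains_R_unimodular_simplex:
  fixes K :: "(real^'n) set"
  assumes K: "convex_body K"
    and cov: "\<And>t. \<exists>c\<in>(\<lambda>x. (1 / real CARD('n)) *\<^sub>R x) ` K. t + c \<in> lattice_points"
  obtains A p where "unimodular_matrix A" "p \<in> K" "\<And>i. column i A + p \<in> K"
proof -
  define d where "d = CARD('n)"
  have d: "d > 0"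
    by (simp add: d_def)
  define C where "C = (\<lambda>x. (1 / real d) *\<^sub>R x) ` K"
  have C: "compact C" "convex C"
    unfolding C_def using K by (auto simp: convex_body_def intro!: compact_scaling convex_scaling)
  obtain b x y where ab: "adapted_basis C d b x y"
    using ex_adapted_basis[OF C] cov unfolding C_def d_def by blast
  have sum_C: "(\<Sum>j<d. f j) \<in> K" if f: "\<And>j. j < d \<Longrightarrow> f j \<in> C" for f
  proof -
    have "(\<Sum>j<d. (1 / real d) *\<^sub>R (real d *\<^sub>R f j)) \<in> K"
    proof (rule convex_sum)
      show "convex K"
        using K by (simp add: convex_body_def)
      show "real d *\<^sub>R f i \<in> K" if "i \<in> {..<d}" for i
        using f[of i] that d by (auto simp: C_def)
    qed (use d in auto)
    then show ?thesis
      using d by simp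
  qed
  obtain f :: "'n \<Rightarrow> nat" where f: "bij_betw f UNIV {..<d}"
    using ex_bij_betw_finite_nat[of "UNIV :: 'n set"] by (auto simp: d_def atLeast0LessThan)
  have f_lt: "f j < d" for j
    using f by (auto simp: bij_betw_def)
  have span: "span (b ` {..<d}) = UNIV"
    using ab dim_eq_full[of "b ` {..<d}"] by (simp add: adapted_basis_def d_def)
  have "unimodular_matrix (\<chi> i j. b (f j) $ i)"
  proof (rule unimodular_matrix_columns)
    show "b (f j) \<in> lattice_points" for j
      using ab f_lt by (simp add: adapted_basis_def)
    fix q :: "real^'n" assume "q \<in> lattice_points"
    then obtain m :: "nat \<Rightarrow> int" where "q = (\<Sum>i<d. of_int (m i) *\<^sub>R b i)"
      using ab span by (auto simp: adapted_basis_def)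
    also have "\<dots> = (\<Sum>j\<in>UNIV. of_int (m (f j)) *\<^sub>R b (f j))"
      using sum.reindex_bij_betw[OF f, of "\<lambda>i. of_int (m i) *\<^sub>R b i"] by simp
    finally show "\<exists>m :: 'n \<Rightarrow> int. q = (\<Sum>j\<in>UNIV. of_int (m j) *\<^sub>R b (f j))"
      by (intro exI[of _ "\<lambda>j. m (f j)"])
  qed
  moreover have "(\<Sum>j<d. y j) \<in> K"
    using ab by (intro sum_C) (simp add: adapted_basis_def)
  moreover have "column i (\<chi> i j. b (f j) $ i) + (\<Sum>j<d. y j) \<in> K" for i
  proof -
    have "b (f i) \<in> parallelepiped d (\<lambda>j. x j - y j)"
      using ab f_lt by (simp add: adapted_basis_def)
    then obtain \<tau> where \<tau>: "b (f i) = (\<Sum>j<d. \<tau> j *\<^sub>R (x j - y j))" "\<forall>j. 0 \<le> \<tau> j \<and> \<tau> j \<le> 1"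
      by (auto simp: parallelepiped_def)
    have "(\<Sum>j<d. (1 - \<tau> j) *\<^sub>R y j + \<tau> j *\<^sub>R x j) \<in> K"
      using ab C(2) \<tau>(2) by (intro sum_C convexD_alt) (auto simp: adapted_basis_def)
    also have "(\<Sum>j<d. (1 - \<tau> j) *\<^sub>R y j + \<tau> j *\<^sub>R x j) = b (f i) + (\<Sum>j<d. y j)"
      unfolding \<tau>(1) sum.distrib[symmetric] by (intro sum.cong) (auto simp: algebra_simps)
    also have "b (f i) = column i (\<chi> i j. b (f j) $ i)"
      by (simp add: column_def vec_eq_iff)
    finally show ?thesis .
  qed
  ultimately show ?thesis
    using that by blast
qed

theorem theorem2p1:
  fixes K :: "(real^'n) set"
  assumes "convex_body K"
  shows "(lattice_width K \<ge> 2 * Flt TYPE('n) * real CARD('n)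
            \<longrightarrow> (\<exists>T. unimodular_map T \<and> T ` std_simplex \<subseteq> K))
       \<and> (lattice_width K \<ge> Flt TYPE('n) * real CARD('n)
            \<longrightarrow> (\<exists>T. R_unimodular_map T \<and> T ` std_simplex \<subseteq> K))"
proof (intro conjI impI)
  let ?d = "real CARD('n)"
  have conv: "convex K"
    using assms by (simp add: convex_body_def)
  {
    assume wide: "Flt TYPE('n) * ?d \<le> lattice_width K"
    have "\<exists>c\<in>(\<lambda>x. (1 / ?d) *\<^sub>R x) ` K. t + c \<in> lattice_points" for t
      by (rule translate_meets_lattice[OF assms _ wide]) simp
    from contains_R_unimodular_simplex[OF assms this]
    obtain A p where "unimodular_matrix A" "p \<in> K" "\<And>i. column i A + p \<in> K"
      by metis
    then show "\<exists>T. R_unimodular_map T \<and> T ` std_simplex \<subseteq> K"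
      unfolding R_unimodular_map_def using affine_image_std_simplex_subset[OF conv] by blast
  }
  assume wide: "2 * Flt TYPE('n) * ?d \<le> lattice_width K"
  define H where "H = (\<lambda>x. (1 / 2) *\<^sub>R x) ` K"
  have H: "convex_body H"
    unfolding H_def using assms by (auto simp: convex_body_def intro!: compact_scaling convex_scaling)
  have H_add: "x + y \<in> K" if "x \<in> H" "y \<in> H" for x y
  proof -
    obtain x' y' where "x' \<in> K" "y' \<in> K" "x = (1/2) *\<^sub>R x'" "y = (1/2) *\<^sub>R y'"
      using \<open>x \<in> H\<close> \<open>y \<in> H\<close> by (auto simp: H_def)
    then show ?thesis
      using convexD[OF conv, of x' y' "1/2" "1/2"] by simp
  qed
  \<comment> \<open>Scaling \<open>H\<close> by \<open>1 / d\<close> is scaling \<open>K\<close> by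
    \<open>1 / (2 d)\<close>, so the doubled width hypothesis is what the covering property of
    \<open>H\<close> asks for.\<close>
  have cov: "\<exists>c\<in>(\<lambda>x. (1 / ?d) *\<^sub>R x) ` H. t + c \<in> lattice_points" for t
    using translate_meets_lattice[OF assms, of "2 * ?d" t] wide
    by (auto simp: H_def image_image mult_ac)
  from contains_R_unimodular_simplex[OF H this]
  obtain A p where A: "unimodular_matrix A" "p \<in> H" "\<And>i. column i A + p \<in> H"
    by metis
  obtain h where h: "h \<in> H" "(p + (1 - 1 / ?d) *\<^sub>R p) + (1 / ?d) *\<^sub>R h \<in> lattice_points"
    using cov[of "p + (1 - 1 / ?d) *\<^sub>R p"] by auto
  \<comment> \<open>A point \<open>q\<close> of \<open>H\<close> with \<open>p + q\<close> in the
    lattice is sought. The scaled copy \<open>H / d\<close>, shifted by \<open>(1 - 1/d) p\<close>,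
    lies in \<open>H\<close> by convexity, and each of its translates still meets the
    lattice.\<close>
  define q where "q = (1 - 1 / ?d) *\<^sub>R p + (1 / ?d) *\<^sub>R h"
  have "q \<in> H"
    unfolding q_def using H A(2) h(1) by (intro convexD_alt) (auto simp: convex_body_def)
  have "p + q \<in> lattice_points"
    using h(2) by (simp add: q_def add.assoc)
  moreover have "p + q \<in> K" "column i A + (p + q) \<in> K" for i
    using H_add[OF A(2) \<open>q \<in> H\<close>] H_add[OF A(3) \<open>q \<in> H\<close>] by (auto simp: add.assoc)
  ultimately show "\<exists>T. unimodular_map T \<and> T ` std_simplex \<subseteq> K"
    unfolding unimodular_map_def using A(1) affine_image_std_simplex_subset[OF conv] by blast
qed

end
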